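(* Let $d\ge1$ be an integer and $\varepsilon\in\{1,-1\}$. Then in $\mathbb{Q}(v)$ $$\sum_{\substack{k,m,n\in\mathbb{N}\\k+m+n=d}}\varepsilon^n\frac{v^{\binom{n+1}2-2km+2k}}{[n]^![2k]^{!!}[2m]^{!!}}=\sum_{\substack{t,k,m,n\in\mathbb{N}\\t+k+m+n=d}}\varepsilon^n\frac{v^{t^2-2dt+t+2nt+\binom{n+1}2-2km-2m}}{[n]^![2k]^{!!}[2m]^{!!}}(v-v^{-1})^t,$$ and this common value equals $0$ if $\varepsilon=-1$, and equals $$\frac{2v^d(v+v^{-1})(v^2+v^{-2})\cdots(v^{d-1}+v^{1-d})}{[d]^!}$$ if $\varepsilon=1$.
   Context: $v$ is an indeterminate; $\mathbb{N}=\{0,1,2,\dots\}$. For integers $m$ and $r\ge0$: $[m]=\frac{v^m-v^{-m}}{v-v^{-1}}$, $[r]^!=\prod_{i=1}^r[i]$, $[2r]^{!!}=\prod_{i=1}^r[2i]$ (empty products are $1$). *)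

theory Defs
  imports
    Complex_Main
    "HOL-Computational_Algebra.Polynomial"
    "HOL-Computational_Algebra.Fraction_Field"
begin

text \<open>The field \<open>\<rat>(v)\<close> is rendered as the fraction field of the polynomial ring over \<^typ>\<open>rat\<close>.\<close>

type_synonym ratfun = "rat poly fract"

definition v :: ratfun
  where "v = Fract [:0, 1:] 1"

definition qint :: "int \<Rightarrow> ratfun"
  where "qint m = (v powi m - v powi (- m)) / (v - inverse v)"

definition qfact :: "nat \<Rightarrow> ratfun"
  where "qfact r = (\<Prod>i=1..r. qint (int i))"

text \<open>\<open>qdfact_even r\<close> is \<open>[2r]!!\<close>: the argument is \<open>r\<close>, not \<open>2r\<close>.\<close>

definition qdfact_even :: "nat \<Rightarrow> ratfun"
  where "qdfact_even r = (\<Prod>i=1..r. qint (2 * int i))"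

end

theory Submission
  imports Defs
begin

text \<open>
  Both sides are shown to equal \<open>u\<^sub>d (1 + \<epsilon>) (1 + \<epsilon> v^2) \<cdots> (1 + \<epsilon> v^(2d-2))\<close>, where
  \<open>u\<^sub>e\<close> is the product of \<open>v^(2-i) / [i]\<close> over \<open>1 \<le> i \<le> e\<close>, called \<open>pair_weight e\<close> below. At
  \<open>\<epsilon> = -1\<close> the first factor vanishes, and at \<open>\<epsilon> = 1\<close> pulling \<open>v^i\<close> out of the factor
  \<open>1 + v^(2i)\<close> turns the product into the stated closed form.

  In both sums the indices \<open>k\<close> and \<open>m\<close> with \<open>k + m = e\<close> fixed can be summed first. In the left-hand
  sum this gives exactly \<open>u\<^sub>e\<close> (\<open>sum_double_factorial_pairs\<close>). With \<open>q = v^2\<close>,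
  and up to factors depending only on \<open>e\<close>, this compares coefficients of \<open>x^e\<close> when the product
  \<open>(1 + qx)(1 + q^2 x)(1 + q^3 x)\<cdots>\<close> is split into its factors of even and odd index and all three
  products are expanded by Euler's identity. On the right-hand side
  \<open>-2km - 2m = (2k - 2km) - 2e\<close>, so the same evaluation applies up to a power of \<open>v\<close>.

  What is left of the left-hand sum is a \<open>q\<close>-binomial expansion (\<open>q_binomial_pair_weight\<close>) at
  \<open>z = \<epsilon>\<close>. What is left of the right-hand sum, for each \<open>t\<close>, is the same expansion for \<open>s = d - t\<close>
  at \<open>z = \<epsilon> v^(2t+2)\<close>. The remaining sum over \<open>s\<close> is a terminating case of the \<open>q\<close>-Chu-Vandermonde
  formula, but it telescopes: all its partial sums are products (\<open>telescoping_pair_weight\<close>).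
\<close>

section \<open>Powers of the indeterminate and quantum integers\<close>

lemma v_nonzero [simp]: "v \<noteq> 0"
  by (simp add: v_def Zero_fract_def eq_fract)

lemma v_power_eq_Fract: "v ^ n = Fract ([:0, 1:] ^ n) 1"
  by (induction n) (simp_all add: v_def One_fract_def)

lemma v_power_neq_one: "n > 0 \<Longrightarrow> v ^ n \<noteq> 1"
proof
  assume "n > 0" "v ^ n = 1"
  then have "[:0, 1:] ^ n = (1 :: rat poly)"
    by (simp add: v_power_eq_Fract One_fract_def eq_fract)
  then have "degree ([:0, 1:] ^ n :: rat poly) = 0" by simp
  with \<open>n > 0\<close> show False by (simp add: degree_power_eq)
qed

lemma v_powi_mult: "v powi a * v powi b = v powi (a + b)"
  by (simp add: power_int_add)

lemma v_powi_power: "(v powi a) ^ n = v powi (a * int n)"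
  by (metis power_int_mult power_int_of_nat)

text \<open>
  Every \<open>[m]\<close> with \<open>m \<noteq> 0\<close>, and hence every factorial below, is invertible because \<open>v\<close> is not a
  root of unity.
\<close>

lemma v_powi_eq_neg_iff: "v powi m = v powi (- m) \<longleftrightarrow> m = 0"
proof
  assume eq: "v powi m = v powi (- m)"
  show "m = 0"
  proof (rule ccontr)
    assume "m \<noteq> 0"
    have "v powi (2 * \<bar>m\<bar>) = 1"
    proof -
      have "v powi (2 * m) = v powi m * v powi m" by (simp add: v_powi_mult)
      also have "\<dots> = v powi m * v powi (- m)" by (subst (2) eq) simp
      also have "\<dots> = 1" by (simp add: v_powi_mult)
      finally have "v powi (2 * m) = 1" .
      moreover from this have "v powi (- (2 * m)) = 1" by (simp add: power_int_minus)
      ultimately show ?thesis by (cases "m \<ge> 0") simp_all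
    qed
    then have "v ^ nat (2 * \<bar>m\<bar>) = 1" by (simp add: power_int_def)
    with \<open>m \<noteq> 0\<close> v_power_neq_one[of "nat (2 * \<bar>m\<bar>)"] show False by simp
  qed
qed simp

lemma v_neq_inverse [simp]: "v \<noteq> inverse v"
  using v_powi_eq_neg_iff[of 1] by (simp add: power_int_minus)

lemma qint_mult_diff: "qint m * (v - inverse v) = v powi m - v powi (- m)"
  by (simp add: qint_def)

lemma qint_eq_0_iff [simp]: "qint m = 0 \<longleftrightarrow> m = 0"
  by (simp add: qint_def v_powi_eq_neg_iff)

lemma qint_0 [simp]: "qint 0 = 0"
  by (simp add: qint_def)

text \<open>
  The form of the addition rule that matches the exponents of the \<open>q\<close>-binomial sum: there each of the
  two summands lowers one of the two indices of a term by one, with a power of \<open>v\<close> that depends only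
  on their sum.
\<close>

lemma qint_add: "qint (m + n) = v powi n * qint m + v powi (- m) * qint n"
proof -
  have "v powi (m + n) - v powi (- (m + n)) =
      v powi n * (v powi m - v powi (- m)) + v powi (- m) * (v powi n - v powi (- n))"
    unfolding right_diff_distrib v_powi_mult by (simp add: add.commute)
  then show ?thesis
    by (simp add: qint_def add_divide_distrib)
qed

lemma qfact_Suc: "qfact (Suc n) = qint (int (Suc n)) * qfact n"
  by (simp add: qfact_def prod.nat_ivl_Suc' )

lemma qdfact_even_Suc: "qdfact_even (Suc n) = qint (2 * int (Suc n)) * qdfact_even n"
  by (simp add: qdfact_even_def prod.nat_ivl_Suc')

lemma qfact_0 [simp]: "qfact 0 = 1" by (simp add: qfact_def)
lemma qdfact_even_0 [simp]: "qdfact_even 0 = 1" by (simp add: qdfact_even_def)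
lemma qfact_nonzero [simp]: "qfact n \<noteq> 0" by (simp add: qfact_def)
lemma qdfact_even_nonzero [simp]: "qdfact_even n \<noteq> 0" by (simp add: qdfact_even_def)

section \<open>Summation over pairs with double factorials\<close>

text \<open>
  The quotient \<open>v^(e - binomial(e, 2)) / [e]!\<close>, written as a product so that its recursion is
  immediate and no binomial coefficient enters the exponents.
\<close>

definition pair_weight :: "nat \<Rightarrow> ratfun"
  where "pair_weight e = (\<Prod>i=1..e. v powi (2 - int i) / qint (int i))"

lemma pair_weight_0 [simp]: "pair_weight 0 = 1" by (simp add: pair_weight_def)

lemma pair_weight_Suc:
  "pair_weight (Suc e) = v powi (1 - int e) / qint (int (Suc e)) * pair_weight e"
  by (simp add: pair_weight_def prod.nat_ivl_Suc')

text \<open>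
  The sum \<open>T\<^sub>e\<close> satisfies the recursion \<open>[e] T\<^sub>e = v^(2-e) T\<^sub>e\<^sub>-\<^sub>1\<close> of \<open>u\<^sub>e\<close>. Exchanging \<open>k\<close> and
  \<open>m = e - k\<close> gives a second expression for \<open>T\<^sub>e\<close>, with \<open>2m\<close> in place of \<open>2k\<close> in the exponent. If
  \<open>[e] T\<^sub>e\<close> is expanded using the first expression for \<open>v^e T\<^sub>e\<close> and the second for \<open>v^(-e) T\<^sub>e\<close>,
  the difference of the \<open>k\<close>-th terms acquires the factor \<open>[2k]\<close>. This cancels the top factor of
  \<open>[2k]!!\<close> and leaves \<open>T\<^sub>e\<^sub>-\<^sub>1\<close>.
\<close>

lemma sum_double_factorial_pairs:
  "(\<Sum>k\<le>e. v powi (2 * int k - 2 * int k * int (e - k)) /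
      (qdfact_even k * qdfact_even (e - k))) = pair_weight e"
proof (induction e)
  case 0
  show ?case by simp
next
  case (Suc e)
  let ?E = "Suc e"
  let ?D = "\<lambda>k. qdfact_even k * qdfact_even (?E - k)"
  let ?T = "\<Sum>k\<le>?E. v powi (2 * int k - 2 * int k * int (?E - k)) / ?D k"
  have swap: "?T = (\<Sum>k\<le>?E. v powi (2 * int (?E - k) - 2 * int k * int (?E - k)) / ?D k)"
    by (rule sum.reindex_bij_witness[of _ "\<lambda>k. ?E - k" "\<lambda>k. ?E - k"])
      (auto simp: mult_ac)
  have term_diff: "v powi int ?E * (v powi (2 * int k - 2 * int k * int (?E - k)) / ?D k)
      - v powi (- int ?E) * (v powi (2 * int (?E - k) - 2 * int k * int (?E - k)) / ?D k)
      = v powi (int ?E - 2 * int k * int (?E - k)) * (qint (2 * int k) / ?D k) * (v - inverse v)"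
    if "k \<le> ?E" for k
  proof -
    define m where "m = ?E - k"
    have E: "int ?E = int k + int m" using that by (simp add: m_def)
    have "v powi int ?E * v powi (2 * int k - 2 * int k * int m)
      - v powi (- int ?E) * v powi (2 * int m - 2 * int k * int m)
      = v powi (int ?E - 2 * int k * int m) * (v powi (2 * int k) - v powi (- (2 * int k)))"
      unfolding E right_diff_distrib v_powi_mult by (simp add: algebra_simps)
    also have "\<dots> = v powi (int ?E - 2 * int k * int m) * (qint (2 * int k) * (v - inverse v))"
      by (simp only: qint_mult_diff)
    finally show ?thesis
      unfolding m_def[symmetric] by (simp add: diff_divide_distrib[symmetric] mult.assoc)
  qed
  have "qint (int ?E) * ?T * (v - inverse v) = (qint (int ?E) * (v - inverse v)) * ?T"
    by (simp only: mult_ac)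
  also have "\<dots> = v powi int ?E * ?T - v powi (- int ?E) * ?T"
    by (simp only: qint_mult_diff left_diff_distrib)
  also have "\<dots> = v powi int ?E * ?T - v powi (- int ?E) *
      (\<Sum>k\<le>?E. v powi (2 * int (?E - k) - 2 * int k * int (?E - k)) / ?D k)"
    by (subst (2) swap) (rule refl)
  also have "\<dots> = (\<Sum>k\<le>?E. v powi (int ?E - 2 * int k * int (?E - k)) * (qint (2 * int k) / ?D k)
      * (v - inverse v))"
    unfolding sum_distrib_left sum_subtractf[symmetric]
    by (intro sum.cong refl term_diff) simp
  also have "\<dots> = (\<Sum>k\<le>?E. v powi (int ?E - 2 * int k * int (?E - k)) * (qint (2 * int k) / ?D k))
      * (v - inverse v)"
    by (simp only: sum_distrib_right)
  finally have "qint (int ?E) * ?T =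
      (\<Sum>k\<le>?E. v powi (int ?E - 2 * int k * int (?E - k)) * (qint (2 * int k) / ?D k))"
    by simp
  also have "\<dots> = (\<Sum>k\<le>e. v powi (int ?E - 2 * int (Suc k) * int (e - k)) *
      (qint (2 * int (Suc k)) / (qdfact_even (Suc k) * qdfact_even (e - k))))"
    by (subst sum.atMost_Suc_shift) (simp add: qint_def)
  also have "\<dots> = (\<Sum>k\<le>e. v powi (1 - int e) * (v powi (2 * int k - 2 * int k * int (e - k)) /
      (qdfact_even k * qdfact_even (e - k))))"
  proof (intro sum.cong refl)
    fix k assume "k \<in> {..e}"
    then have "int ?E - 2 * int (Suc k) * int (e - k) =
        (1 - int e) + (2 * int k - 2 * int k * int (e - k))"
      by (simp add: algebra_simps of_nat_diff)
    then show "v powi (int ?E - 2 * int (Suc k) * int (e - k)) *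
        (qint (2 * int (Suc k)) / (qdfact_even (Suc k) * qdfact_even (e - k))) =
        v powi (1 - int e) * (v powi (2 * int k - 2 * int k * int (e - k)) /
        (qdfact_even k * qdfact_even (e - k)))"
      by (simp only: qdfact_even_Suc v_powi_mult[symmetric]) (simp (no_asm))
  qed
  also have "\<dots> = v powi (1 - int e) * pair_weight e"
    by (simp only: sum_distrib_left[symmetric] Suc.IH)
  finally show ?case
    by (simp add: pair_weight_Suc field_simps)
qed

section \<open>The remaining binomial and telescoping sums\<close>

text \<open>
  This is the \<open>q\<close>-binomial theorem for \<open>q = v^2\<close>, with the \<open>q\<close>-binomial coefficient distributed over
  the two weights. After multiplication by \<open>[d+1]\<close>, the addition rule for quantum integers splits the
  sum for \<open>d + 1\<close> into two multiples of the sum for \<open>d\<close>: one lowers \<open>n\<close> and contributes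
  \<open>z v^(d+1)\<close>, the other lowers \<open>d + 1 - n\<close> and contributes \<open>v^(1-d)\<close>.
\<close>

lemma q_binomial_pair_weight:
  "(\<Sum>n\<le>d. z ^ n * v powi int ((n + 1) choose 2) / qfact n * pair_weight (d - n))
     = pair_weight d * (\<Prod>i<d. 1 + z * v powi (2 * int i))"
proof (induction d)
  case 0
  show ?case by (simp add: numeral_2_eq_2)
next
  case (Suc d)
  define w where "w n = z ^ n * v powi int ((n + 1) choose 2) / qfact n" for n
  have w_Suc: "qint (int (Suc n)) * w (Suc n) = z * v powi int (Suc n) * w n" for n
  proof -
    have "int ((Suc n + 1) choose 2) = int (Suc n) + int ((n + 1) choose 2)"
      by (simp add: numeral_2_eq_2)
    then show ?thesis
      by (simp only: w_def qfact_Suc v_powi_mult[symmetric]) (simp add: field_simps)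
  qed
  have pair_Suc: "qint (int (Suc e)) * pair_weight (Suc e) = v powi (1 - int e) * pair_weight e" for e
    by (simp add: pair_weight_Suc)
  let ?S = "\<Sum>n\<le>d. w n * pair_weight (d - n)"
  have "qint (int (Suc d)) * (\<Sum>n\<le>Suc d. w n * pair_weight (Suc d - n))
     = (\<Sum>n\<le>Suc d. v powi int (Suc d - n) * (qint (int n) * w n) * pair_weight (Suc d - n))
     + (\<Sum>n\<le>Suc d. v powi (- int n) * w n * (qint (int (Suc d - n)) * pair_weight (Suc d - n)))"
    unfolding sum_distrib_left sum.distrib[symmetric]
  proof (intro sum.cong refl)
    fix n assume "n \<in> {..Suc d}"
    then have "int (Suc d) = int n + int (Suc d - n)" by simp
    then have "qint (int (Suc d)) =
        v powi int (Suc d - n) * qint (int n) + v powi (- int n) * qint (int (Suc d - n))"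
      by (metis qint_add)
    then show "qint (int (Suc d)) * (w n * pair_weight (Suc d - n)) =
        v powi int (Suc d - n) * (qint (int n) * w n) * pair_weight (Suc d - n) +
        v powi (- int n) * w n * (qint (int (Suc d - n)) * pair_weight (Suc d - n))"
      by (simp only:) (simp only: algebra_simps)
  qed
  also have "(\<Sum>n\<le>Suc d. v powi int (Suc d - n) * (qint (int n) * w n) * pair_weight (Suc d - n))
      = (\<Sum>n\<le>d. v powi int (d - n) * (z * v powi int (Suc n) * w n) * pair_weight (d - n))"
    by (subst sum.atMost_Suc_shift) (simp only: w_Suc, simp)
  also have "\<dots> = z * v powi int (Suc d) * ?S"
    unfolding sum_distrib_left
  proof (intro sum.cong refl)
    fix n assume "n \<in> {..d}"
    then have "int (Suc d) = int (d - n) + int (Suc n)" by simp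
    then show "v powi int (d - n) * (z * v powi int (Suc n) * w n) * pair_weight (d - n) =
        z * v powi int (Suc d) * (w n * pair_weight (d - n))"
      by (simp only: v_powi_mult[symmetric] mult_ac)
  qed
  also have "(\<Sum>n\<le>Suc d. v powi (- int n) * w n * (qint (int (Suc d - n)) * pair_weight (Suc d - n)))
      = (\<Sum>n\<le>d. v powi (- int n) * w n * (qint (int (Suc (d - n))) * pair_weight (Suc (d - n))))"
    by (simp add: Suc_diff_le del: of_nat_Suc of_nat_diff)
  also have "\<dots> = v powi (1 - int d) * ?S"
    unfolding sum_distrib_left
  proof (intro sum.cong refl)
    fix n assume "n \<in> {..d}"
    then have "1 - int d = - int n + (1 - int (d - n))" by simp
    then show "v powi (- int n) * w n * (qint (int (Suc (d - n))) * pair_weight (Suc (d - n))) =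
        v powi (1 - int d) * (w n * pair_weight (d - n))"
      by (simp only: pair_Suc v_powi_mult[symmetric]) (simp (no_asm) only: mult_ac)
  qed
  also have "z * v powi int (Suc d) * ?S + v powi (1 - int d) * ?S
      = v powi (1 - int d) * (1 + z * v powi (2 * int d)) * ?S"
  proof -
    have "v powi int (Suc d) = v powi (1 - int d) * v powi (2 * int d)"
      by (simp add: v_powi_mult add.commute)
    then show ?thesis by (simp only:) (simp add: algebra_simps)
  qed
  also have "?S = pair_weight d * (\<Prod>i<d. 1 + z * v powi (2 * int i))"
    using Suc.IH by (simp only: w_def)
  finally show ?case
    unfolding w_def by (simp add: pair_weight_Suc field_simps)
qed

text \<open>
  In terms of \<open>q = v^2\<close>, the \<open>s\<close>-th summand is \<open>(-1)^s (w + 1)(w + q)\<cdots>(w + q^(s-1))\<close> divided by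
  \<open>(1 - q)\<cdots>(1 - q^s)\<close>, and the partial sum is the same expression with \<open>w + q, \<dots>, w + q^N\<close> in the
  numerator. Going from \<open>N\<close> to \<open>N + 1\<close> amounts to \<open>(w + 1) - (1 - q^(N+1)) = w + q^(N+1)\<close>. Leaving
  \<open>w\<close> and \<open>N\<close> independent is what makes this induction possible; the application sets
  \<open>w = z v^(2d)\<close> and \<open>N = d\<close>.
\<close>

lemma telescoping_pair_weight:
  fixes w :: ratfun
  defines "c \<equiv> \<lambda>s. v powi ((int s)\<^sup>2 - 3 * int s) * pair_weight s / (v - inverse v) ^ s"
  shows "(\<Sum>s\<le>N. c s * (\<Prod>j<s. 1 + w * v powi (- (2 * int j))))
     = c N * v powi (2 * int N) * (\<Prod>j=1..N. 1 + w * v powi (- (2 * int j)))"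
proof (induction N)
  case 0
  show ?case by (simp add: c_def)
next
  case (Suc N)
  let ?P = "\<Prod>j=1..N. 1 + w * v powi (- (2 * int j))"
  have c_step: "c N * v powi (2 * int N) = c (Suc N) * (v powi (2 * int (Suc N)) - 1)"
  proof -
    have "v powi (2 * int (Suc N)) - 1 = v powi int (Suc N) * (v powi int (Suc N) - v powi (- int (Suc N)))"
      unfolding right_diff_distrib v_powi_mult by simp
    then have *: "v powi (2 * int (Suc N)) - 1 = v powi int (Suc N) * (qint (int (Suc N)) * (v - inverse v))"
      by (simp only: qint_mult_diff)
    have "v powi ((int (Suc N))\<^sup>2 - 3 * int (Suc N)) * v powi (1 - int N) * v powi int (Suc N)
        = v powi ((int N)\<^sup>2 - 3 * int N) * v powi (2 * int N)"
      unfolding v_powi_mult by (simp add: power2_eq_square algebra_simps)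
    moreover have "a * (p / l ^ N) * b = x * (y / q * p) / l ^ Suc N * (z * (q * l))"
      if "x * y * z = a * b" "q \<noteq> 0" "l \<noteq> 0" for a b p l x y z q :: ratfun
      using that(2,3) by (simp add: that(1)[symmetric])
    ultimately show ?thesis
      unfolding * c_def pair_weight_Suc by simp
  qed
  have split_prod: "(\<Prod>j<Suc N. 1 + w * v powi (- (2 * int j))) = (1 + w) * ?P"
    unfolding One_nat_def prod.lessThan_Suc_shift prod.atLeast_Suc_atMost_Suc_shift
      prod.atLeast1_atMost_eq[unfolded One_nat_def] by simp
  have "(\<Sum>s\<le>Suc N. c s * (\<Prod>j<s. 1 + w * v powi (- (2 * int j))))
      = c (Suc N) * (v powi (2 * int (Suc N)) - 1) * ?P + c (Suc N) * ((1 + w) * ?P)"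
    by (simp only: sum.atMost_Suc Suc.IH c_step split_prod)
  also have "\<dots> = c (Suc N) * ((v powi (2 * int (Suc N)) + w) * ?P)"
    by (simp add: algebra_simps del: of_nat_Suc)
  also have "v powi (2 * int (Suc N)) + w =
      v powi (2 * int (Suc N)) * (1 + w * v powi (- (2 * int (Suc N))))"
    by (simp only: distrib_left mult.left_commute[of _ w] v_powi_mult) simp
  finally show ?case by (simp add: mult_ac del: of_nat_Suc)
qed

section \<open>Evaluation of the two multiple sums\<close>

lemma sum_triples:
  "(\<Sum>(k, m, n) \<in> {(k, m, n). k + m + n = d}. f k m n) =
    (\<Sum>n\<le>d. \<Sum>k\<le>d - n. f k (d - n - k) n)" for d :: nat
  unfolding sum.Sigma[OF finite_atMost ballI[OF finite_atMost]]
  by (rule sum.reindex_bij_witness[of _ "\<lambda>(n, k). (k, d - n - k, n)" "\<lambda>(k, m, n). (n, k)"]) auto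

lemma sum_quadruples:
  "(\<Sum>(t, k, m, n) \<in> {(t, k, m, n). t + k + m + n = d}. f t k m n) =
    (\<Sum>t\<le>d. \<Sum>n\<le>d - t. \<Sum>k\<le>d - t - n. f t k (d - t - n - k) n)" for d :: nat
  unfolding sum.Sigma[OF finite_atMost ballI[OF finite_atMost]]
    sum.Sigma[OF finite_atMost ballI[OF finite_SigmaI[OF finite_atMost finite_atMost]]]
  by (rule sum.reindex_bij_witness[of _ "\<lambda>(t, n, k). (t, k, d - t - n - k, n)"
        "\<lambda>(t, k, m, n). (t, n, k)"]) auto

lemma triple_sum:
  "(\<Sum>(k, m, n) \<in> {(k, m, n). k + m + n = d}.
      z ^ n * (v powi (int ((n + 1) choose 2) - 2 * int k * int m + 2 * int k) /
        (qfact n * qdfact_even k * qdfact_even m)))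
    = pair_weight d * (\<Prod>i<d. 1 + z * v powi (2 * int i))"
proof -
  have "(\<Sum>k\<le>e. z ^ n * (v powi (int ((n + 1) choose 2) - 2 * int k * int (e - k) + 2 * int k) /
        (qfact n * qdfact_even k * qdfact_even (e - k))))
      = z ^ n * v powi int ((n + 1) choose 2) / qfact n * pair_weight e" for n e
  proof -
    have "int ((n + 1) choose 2) - 2 * int k * int (e - k) + 2 * int k =
        int ((n + 1) choose 2) + (2 * int k - 2 * int k * int (e - k))" for k
      by simp
    then show ?thesis
      unfolding sum_double_factorial_pairs[symmetric] sum_distrib_left
      by (intro sum.cong refl) (simp only: v_powi_mult[symmetric], simp)
  qed
  then show ?thesis
    by (simp only: sum_triples q_binomial_pair_weight)
qed

lemma quadruple_sum:
  "(\<Sum>(t, k, m, n) \<in> {(t, k, m, n). t + k + m + n = d}.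
      z ^ n * (v powi ((int t)^2 - 2 * int d * int t + int t + 2 * int n * int t
          + int ((n + 1) choose 2) - 2 * int k * int m - 2 * int m) /
        (qfact n * qdfact_even k * qdfact_even m)) * (v - inverse v) ^ t)
    = pair_weight d * (\<Prod>i<d. 1 + z * v powi (2 * int i))"
    (is "?lhs = ?rhs")
proof -
  define l where "l = v - inverse v"
  define g where "g t = (int t)\<^sup>2 - 2 * int d * int t + int t - 2 * int (d - t)" for t
  define w where "w = z * v powi (2 * int d)"
  \<comment> \<open>The mixed factor \<open>v^(2nt)\<close>, together with the part \<open>v^(2n)\<close> of \<open>v^(-2(k+m)) = v^(2n - 2(d-t))\<close>,
    is absorbed by rescaling \<open>z\<close>.\<close>
  have inner: "(\<Sum>k\<le>d - t - n. z ^ n * (v powi ((int t)^2 - 2 * int d * int t + int t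
          + 2 * int n * int t + int ((n + 1) choose 2) - 2 * int k * int (d - t - n - k)
          - 2 * int (d - t - n - k)) /
        (qfact n * qdfact_even k * qdfact_even (d - t - n - k))) * l ^ t)
      = l ^ t * v powi g t * ((z * v powi (2 * int t + 2)) ^ n * v powi int ((n + 1) choose 2)
          / qfact n * pair_weight (d - t - n))"
    if "t \<le> d" "n \<le> d - t" for t n
    unfolding sum_double_factorial_pairs[symmetric] sum_distrib_left
  proof (intro sum.cong refl)
    fix k assume "k \<in> {..d - t - n}"
    then have "int (d - t - n - k) = int d - int t - int n - int k"
      using that by simp
    then have exponent: "(int t)^2 - 2 * int d * int t + int t + 2 * int n * int t
          + int ((n + 1) choose 2)
          - 2 * int k * int (d - t - n - k) - 2 * int (d - t - n - k)
        = g t + ((2 * int t + 2) * int n + (int ((n + 1) choose 2)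
          + (2 * int k - 2 * int k * int (d - t - n - k))))"
      using that by (simp add: g_def of_nat_diff algebra_simps)
    have power: "(z * v powi (2 * int t + 2)) ^ n = z ^ n * v powi ((2 * int t + 2) * int n)"
      by (simp only: power_mult_distrib v_powi_power)
    show "z ^ n * (v powi ((int t)^2 - 2 * int d * int t + int t
          + 2 * int n * int t + int ((n + 1) choose 2) - 2 * int k * int (d - t - n - k)
          - 2 * int (d - t - n - k)) /
        (qfact n * qdfact_even k * qdfact_even (d - t - n - k))) * l ^ t
      = l ^ t * v powi g t * ((z * v powi (2 * int t + 2)) ^ n * v powi int ((n + 1) choose 2)
          / qfact n * (v powi (2 * int k - 2 * int k * int (d - t - n - k)) /
            (qdfact_even k * qdfact_even (d - t - n - k))))"
      unfolding exponent power v_powi_mult[symmetric, of "g t"]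
        v_powi_mult[symmetric, of "(2 * int t + 2) * int n"]
        v_powi_mult[symmetric, of "int ((n + 1) choose 2)"]
      by (simp only: times_divide_eq_left times_divide_eq_right divide_divide_eq_left mult_ac)
  qed
  have "?lhs = (\<Sum>t\<le>d. l ^ t * v powi g t * (pair_weight (d - t) *
      (\<Prod>i<d - t. 1 + z * v powi (2 * int t + 2) * v powi (2 * int i))))"
    unfolding sum_quadruples l_def[symmetric] q_binomial_pair_weight[symmetric] sum_distrib_left
    by (intro sum.cong refl inner) simp_all
  also have "\<dots> = (\<Sum>s\<le>d. l ^ (d - s) * v powi g (d - s) * (pair_weight s *
      (\<Prod>i<s. 1 + z * v powi (2 * int (d - s) + 2) * v powi (2 * int i))))"
    by (rule sum.reindex_bij_witness[of _ "\<lambda>s. d - s" "\<lambda>s. d - s"]) auto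
  \<comment> \<open>Listed in decreasing order, the exponents \<open>2(d - s) + 2 + 2i\<close> for \<open>i < s\<close> are \<open>2d - 2j\<close> for
    \<open>j < s\<close>, so all the products are initial parts of a single one and the sum telescopes.\<close>
  also have "\<dots> = (\<Sum>s\<le>d. l ^ d * v powi (int d - (int d)\<^sup>2) *
      (v powi ((int s)\<^sup>2 - 3 * int s) * pair_weight s / l ^ s *
        (\<Prod>j<s. 1 + w * v powi (- (2 * int j)))))"
  proof (intro sum.cong refl)
    fix s assume "s \<in> {..d}"
    then have s: "s \<le> d" by simp
    have "(\<Prod>i<s. 1 + z * v powi (2 * int (d - s) + 2) * v powi (2 * int i))
        = (\<Prod>j<s. 1 + z * v powi (2 * int (d - s) + 2) * v powi (2 * int (s - Suc j)))"
      by (rule prod.nat_diff_reindex[symmetric])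
    also have "\<dots> = (\<Prod>j<s. 1 + w * v powi (- (2 * int j)))"
    proof (intro prod.cong refl)
      fix j assume "j \<in> {..<s}"
      then have "2 * int (d - s) + 2 + 2 * int (s - Suc j) = 2 * int d + - (2 * int j)"
        using s by (simp add: of_nat_diff)
      then show "1 + z * v powi (2 * int (d - s) + 2) * v powi (2 * int (s - Suc j)) =
          1 + w * v powi (- (2 * int j))"
        unfolding w_def mult.assoc v_powi_mult by (simp only:)
    qed
    finally have reversed: "(\<Prod>i<s. 1 + z * v powi (2 * int (d - s) + 2) * v powi (2 * int i)) =
        (\<Prod>j<s. 1 + w * v powi (- (2 * int j)))" .
    have "g (d - s) = (int d - (int d)\<^sup>2) + ((int s)\<^sup>2 - 3 * int s)"
      using s by (simp add: g_def of_nat_diff power2_eq_square algebra_simps)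
    moreover have "l ^ (d - s) = l ^ d / l ^ s"
      using s by (simp add: power_diff l_def)
    ultimately show "l ^ (d - s) * v powi g (d - s) * (pair_weight s *
        (\<Prod>i<s. 1 + z * v powi (2 * int (d - s) + 2) * v powi (2 * int i)))
      = l ^ d * v powi (int d - (int d)\<^sup>2) *
        (v powi ((int s)\<^sup>2 - 3 * int s) * pair_weight s / l ^ s *
          (\<Prod>j<s. 1 + w * v powi (- (2 * int j))))"
      unfolding reversed by (simp only: v_powi_mult[symmetric]) simp
  qed
  also have "\<dots> = l ^ d * v powi (int d - (int d)\<^sup>2) *
      (v powi ((int d)\<^sup>2 - 3 * int d) * pair_weight d / l ^ d * v powi (2 * int d) *
        (\<Prod>j=1..d. 1 + w * v powi (- (2 * int j))))"
    unfolding sum_distrib_left[symmetric] l_def telescoping_pair_weight ..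
  also have "(\<Prod>j=1..d. 1 + w * v powi (- (2 * int j))) = (\<Prod>i<d. 1 + z * v powi (2 * int i))"
    unfolding w_def mult.assoc v_powi_mult
    by (rule prod.reindex_bij_witness[of _ "\<lambda>i. d - i" "\<lambda>j. d - j"])
      (auto simp: of_nat_diff algebra_simps)
  also have "l ^ d * v powi (int d - (int d)\<^sup>2) *
      (v powi ((int d)\<^sup>2 - 3 * int d) * pair_weight d / l ^ d * v powi (2 * int d) * p)
      = pair_weight d * p" for p
  proof -
    have "v powi (int d - (int d)\<^sup>2) * v powi ((int d)\<^sup>2 - 3 * int d) * v powi (2 * int d) = 1"
      unfolding v_powi_mult by simp
    moreover have "L * a * (b * q / L * c * p) = q * p"
      if "a * b * c = 1" "L \<noteq> 0" for L a b c q :: ratfun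
    proof -
      have "L * a * (b * q / L * c * p) = (a * b * c) * (q * p)" using that(2) by simp
      then show ?thesis by (simp add: that(1))
    qed
    ultimately show ?thesis by (simp add: l_def)
  qed
  finally show ?thesis .
qed

text \<open>
  The factors \<open>v^(2-i)\<close> of \<open>u\<^sub>e\<^sub>+\<^sub>1\<close> for \<open>i \<le> e + 1\<close> and the \<open>v^i\<close> pulled out of \<open>1 + v^(2i)\<close> for
  \<open>1 \<le> i \<le> e\<close> multiply to \<open>v^(e+1)\<close>, and the factor for \<open>i = 0\<close> is the leading \<open>2\<close>.
\<close>

lemma pair_weight_prod_one:
  "pair_weight (Suc e) * (\<Prod>i<Suc e. 1 + v powi (2 * int i))
    = 2 * v ^ Suc e * (\<Prod>i=1..e. v powi int i + v powi (- int i)) / qfact (Suc e)"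
proof (induction e)
  case 0
  show ?case by (simp add: pair_weight_Suc qfact_Suc)
next
  case (Suc e)
  let ?F = "\<lambda>e. pair_weight e * (\<Prod>i<e. 1 + v powi (2 * int i))"
  have factor: "v powi (1 - int (Suc e)) * (1 + v powi (2 * int (Suc e)))
      = v * (v powi int (Suc e) + v powi (- int (Suc e)))"
  proof -
    have "v * x = v powi 1 * x" for x by simp
    then show ?thesis
      by (simp only: distrib_left v_powi_mult mult_1_right) (simp add: add.commute)
  qed
  have "?F (Suc (Suc e)) = ?F (Suc e) * (v powi (1 - int (Suc e)) * (1 + v powi (2 * int (Suc e))))
      / qint (int (Suc (Suc e)))"
    unfolding pair_weight_Suc[of "Suc e"] prod.lessThan_Suc[of _ "Suc e"] by simp
  also have "\<dots> = 2 * v ^ Suc e * (\<Prod>i=1..e. v powi int i + v powi (- int i)) / qfact (Suc e) *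
      (v * (v powi int (Suc e) + v powi (- int (Suc e)))) / qint (int (Suc (Suc e)))"
    by (simp only: factor Suc.IH)
  also have "\<dots> = 2 * v ^ Suc (Suc e) * (\<Prod>i=1..Suc e. v powi int i + v powi (- int i)) /
      qfact (Suc (Suc e))"
    unfolding qfact_Suc[of "Suc e"] power_Suc[of v "Suc e"]
    by (simp only: prod.cl_ivl_Suc) (simp add: mult_ac)
  finally show ?case .
qed

theorem theoremC:
  fixes d :: nat and \<epsilon> :: int
  assumes "d \<ge> 1" and "\<epsilon> \<in> {1, -1}"
  shows
    "let A = (\<Sum>(k, m, n) \<in> {(k, m, n). k + m + n = d}.
               of_int \<epsilon> ^ n *
               (v powi (int ((n + 1) choose 2) - 2 * int k * int m + 2 * int k) /
                (qfact n * qdfact_even k * qdfact_even m)));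
         B = (\<Sum>(t, k, m, n) \<in> {(t, k, m, n). t + k + m + n = d}.
               of_int \<epsilon> ^ n *
               (v powi ((int t)^2 - 2 * int d * int t + int t + 2 * int n * int t
                        + int ((n + 1) choose 2) - 2 * int k * int m - 2 * int m) /
                (qfact n * qdfact_even k * qdfact_even m)) *
               (v - inverse v) ^ t)
     in A = B \<and>
        (\<epsilon> = -1 \<longrightarrow> A = 0) \<and>
        (\<epsilon> = 1 \<longrightarrow>
           A = 2 * v ^ d * (\<Prod>i=1..d - 1. (v powi (int i) + v powi (- int i))) / qfact d)"
proof -
  let ?P = "\<lambda>z. pair_weight d * (\<Prod>i<d. 1 + z * v powi (2 * int i))"
  obtain e where d: "d = Suc e"
    using assms(1) by (cases d) auto
  have zero: "?P (of_int (- 1)) = 0"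
    by (simp add: d prod.lessThan_Suc_shift del: prod.lessThan_Suc)
  have one: "?P (of_int 1) =
      2 * v ^ d * (\<Prod>i=1..d - 1. v powi int i + v powi (- int i)) / qfact d"
    using pair_weight_prod_one[of e] by (simp only: d of_int_1 mult_1_left diff_Suc_1)
  show ?thesis
    unfolding Let_def triple_sum quadruple_sum using zero one by blast
qed

end
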